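(* Let $G_\star$ be a constant symmetric operator and suppose every accepted exact secant satisfies $y_i=G_\star s_i$. Let $B_{i+1}$ be obtained from the symmetric operator $B_i$ by the direct SR1 update $$B_{i+1}=B_i+\frac{v_iv_i^\top}{\langle v_i,s_i\rangle},\qquad v_i=y_i-B_is_i,$$ and assume each of these updates is well defined. Set $E_i:=B_i-G_\star$. Then $$E_{i+1}=E_i-\frac{E_is_is_i^\top E_i}{s_i^\top E_is_i},$$ and $$E_{i+1}s_i=0,\qquad \ker(E_i)\subseteq\ker(E_{i+1}).$$ Consequently, if a finite set of accepted directions $s_{i_1},\dots,s_{i_r}$ spans a subspace $\mathcal V$, then after those updates the model $B$ satisfies $$(B-G_\star)v=0\qquad\text{for every }v\in\mathcal V .$$ In particular, the transported Dennis–Moré condition holds for every later transported direction contained in $\mathcal V$: for such nonzero directions $d_k\in\mathcal V$ one has $\|(B_k-\overline G_k)d_k\|/\|d_k\|\to0$.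
   Context: $\mathcal H$ is a finite-dimensional real Hilbert space (identified with Euclidean space); $ab^\top$ denotes $h\mapsto\langle b,h\rangle a$. The setting is a quadratic smooth term $f$, with $\gamma>0$ and $G_\star=I+\gamma\nabla^2f$ constant. For a center $z_k$, $\phi_k(x)=\gamma f(x)+\frac12\|x-z_k\|^2$, $p_k=\arg\min\phi_k$; a transported direction is $d_k=a_{k-1}-p_k$ with $a_{k-1}$ an anchor point, and $\overline G_k=\int_0^1\nabla^2\phi_k(p_k+td_k)\,dt$ (which equals $G_\star$ here). $B_k$ is the current direct SR1 model at outer iteration $k$, obtained from the sequence of accepted updates. "Well defined" means the denominator $\langle v_i,s_i\rangle$ is nonzero. *)

theory Defs
  imports "HOL-Analysis.Analysis"
begin

definition symmetric_op :: "('a::euclidean_space \<Rightarrow>\<^sub>L 'a) \<Rightarrow> bool" where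
  "symmetric_op A \<longleftrightarrow> (\<forall>x y. A x \<bullet> y = x \<bullet> A y)"

definition outer :: "'a::euclidean_space \<Rightarrow> 'a \<Rightarrow> ('a \<Rightarrow>\<^sub>L 'a)" where
  "outer a b = Blinfun (\<lambda>h. (b \<bullet> h) *\<^sub>R a)"

lemma outer_apply [simp]: "blinfun_apply (outer a b) h = (b \<bullet> h) *\<^sub>R a"
proof -
  have "bounded_linear (\<lambda>h. (b \<bullet> h) *\<^sub>R a)"
    by (intro bounded_linear_scaleR_const bounded_linear_inner_right)
  then show ?thesis
    by (simp add: outer_def bounded_linear_Blinfun_apply)
qed

definition op_ker :: "('a::euclidean_space \<Rightarrow>\<^sub>L 'a) \<Rightarrow> 'a set" where
  "op_ker A = {h. A h = 0}"

definition grad :: "('a::euclidean_space \<Rightarrow> real) \<Rightarrow> 'a \<Rightarrow> 'a" where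
  "grad f x = (THE g. GDERIV f x :> g)"

(* Blinfun only bundles the derivative of the gradient as a bounded operator; both this
   and grad are meaningful only where f is twice differentiable. *)
definition hessian :: "('a::euclidean_space \<Rightarrow> real) \<Rightarrow> 'a \<Rightarrow> ('a \<Rightarrow>\<^sub>L 'a)" where
  "hessian f x = Blinfun (frechet_derivative (grad f) (at x))"

(* No sign condition on A: convexity of f is not part of the setting. *)
definition quadratic_function :: "('a::euclidean_space \<Rightarrow> real) \<Rightarrow> bool" where
  "quadratic_function f \<longleftrightarrow>
     (\<exists>A b c. symmetric_op A \<and> (\<forall>x. f x = 1 / 2 * (x \<bullet> A x) + b \<bullet> x + c))"

definition prox_objective ::
    "real \<Rightarrow> ('a::euclidean_space \<Rightarrow> real) \<Rightarrow> 'a \<Rightarrow> 'a \<Rightarrow> real" where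
  "prox_objective \<gamma> f z x = \<gamma> * f x + 1 / 2 * (norm (x - z))\<^sup>2"

definition averaged_hessian ::
    "('a::euclidean_space \<Rightarrow> real) \<Rightarrow> 'a \<Rightarrow> 'a \<Rightarrow> ('a \<Rightarrow>\<^sub>L 'a)" where
  "averaged_hessian \<phi> p d = integral {0..1} (\<lambda>t. hessian \<phi> (p + t *\<^sub>R d))"

(* The limit is taken along the iterations k in K only; it is vacuous if K is finite. *)
definition dennis_more_along ::
    "nat set \<Rightarrow> (nat \<Rightarrow> ('a::euclidean_space \<Rightarrow>\<^sub>L 'a)) \<Rightarrow> (nat \<Rightarrow> ('a \<Rightarrow>\<^sub>L 'a)) \<Rightarrow> (nat \<Rightarrow> 'a) \<Rightarrow> bool"
  where
  "dennis_more_along K M Gbar d \<longleftrightarrow>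
     ((\<lambda>k. norm ((M k - Gbar k) (d k)) / norm (d k)) \<longlongrightarrow> 0) (inf sequentially (principal K))"

end

theory Submission
  imports Defs
begin

text \<open>The error \<open>E\<^sub>i = B\<^sub>i - G\<close> satisfies \<open>v\<^sub>i = - E\<^sub>i s\<^sub>i\<close>, and since \<open>E\<^sub>i\<close> is symmetric,
  an SR1 update is one step of rank-one deflation of \<open>E\<^sub>i\<close>: it adds \<open>s\<^sub>i\<close> to the kernel and
  loses nothing that was already there. Kernels are subspaces, hence contain the span of
  all earlier steps. For quadratic \<open>f\<close> the averaged Hessian is \<open>G\<close> itself, so the Dennis-More
  quotients vanish identically.\<close>

lemma symmetric_op_diff:
  "symmetric_op A \<Longrightarrow> symmetric_op B \<Longrightarrow> symmetric_op (A - B)"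
  by (simp add: symmetric_op_def blinfun.diff_left inner_diff_left inner_diff_right)

lemma symmetric_op_rank_one_update:
  "symmetric_op A \<Longrightarrow> symmetric_op (A + outer v v /\<^sub>R r)"
  by (simp add: symmetric_op_def blinfun.add_left blinfun.scaleR_left inner_add_left
      inner_add_right inner_commute mult.assoc)

lemma subspace_op_ker: "subspace (op_ker A)"
  by (auto simp: subspace_def op_ker_def blinfun.add_right blinfun.scaleR_right)

text \<open>By symmetry the scalar \<open>u \<bullet> E h\<close> equals
  \<open>E u \<bullet> h\<close>. This links the \<open>v\<close>-form of the SR1 correction to the
  sandwiched form in the error recursion.\<close>

lemma symmetric_op_compose_outer:
  fixes E :: "'a::euclidean_space \<Rightarrow>\<^sub>L 'a"
  assumes "symmetric_op E"
  shows "E o\<^sub>L outer u u o\<^sub>L E = outer (E u) (E u)"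
  using assms by (intro blinfun_eqI) (simp add: symmetric_op_def blinfun.scaleR_right)

text \<open>Wedderburn rank reduction for symmetric \<open>E\<close>. If
  \<open>u \<bullet> E u = 0\<close>, the inverse of zero is zero and the result is \<open>E\<close>
  itself.\<close>

definition deflate :: "('a::euclidean_space \<Rightarrow>\<^sub>L 'a) \<Rightarrow> 'a \<Rightarrow> ('a \<Rightarrow>\<^sub>L 'a)" where
  "deflate E u = E - (E o\<^sub>L outer u u o\<^sub>L E) /\<^sub>R (u \<bullet> E u)"

lemma deflate_direction:
  fixes E :: "'a::euclidean_space \<Rightarrow>\<^sub>L 'a"
  assumes "u \<bullet> E u \<noteq> 0"
  shows "deflate E u u = 0"
  using assms by (simp add: deflate_def blinfun.diff_left blinfun.scaleR_left blinfun.scaleR_right)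

text \<open>Both terms of \<open>deflate E u\<close> apply \<open>E\<close> first, so what
  \<open>E\<close> annihilates stays annihilated, whatever the denominator is.\<close>

lemma op_ker_deflate: "op_ker E \<subseteq> op_ker (deflate E u)"
  by (auto simp: op_ker_def deflate_def blinfun.diff_left blinfun.scaleR_left)

text \<open>The sign in \<open>v = - (B - G) u\<close> cancels in \<open>outer v v\<close> but
  survives in \<open>v \<bullet> u\<close>, which turns the added correction into a subtracted
  one.\<close>

lemma SR1_error_update:
  fixes B G :: "'a::euclidean_space \<Rightarrow>\<^sub>L 'a"
  assumes "symmetric_op (B - G)" and "v = G u - B u"
  shows "B + outer v v /\<^sub>R (v \<bullet> u) - G = deflate (B - G) u"
proof -
  have v: "v = - ((B - G) u)"
    using assms(2) by (simp add: blinfun.diff_left)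
  have "outer v v = outer ((B - G) u) ((B - G) u)"
    by (intro blinfun_eqI) (simp add: v)
  moreover have "v \<bullet> u = - (u \<bullet> (B - G) u)"
    by (simp add: v inner_commute)
  ultimately show ?thesis
    by (simp add: deflate_def symmetric_op_compose_outer[OF assms(1)])
qed

lemma grad_eqI: "GDERIV f x :> g \<Longrightarrow> grad f x = g"
  unfolding grad_def
proof (rule the_equality)
  fix h assume "GDERIV f x :> g" "GDERIV f x :> h"
  then have "(\<lambda>k. k \<bullet> h) = (\<lambda>k. k \<bullet> g)"
    unfolding gderiv_def by (rule has_derivative_unique[rotated])
  then show "h = g"
    by (metis inner_commute vector_eq_ldot)
qed

lemma hessian_quadratic:
  fixes A :: "'a::euclidean_space \<Rightarrow>\<^sub>L 'a"
  assumes "symmetric_op A" and f: "\<And>x. f x = 1 / 2 * (x \<bullet> A x) + b \<bullet> x + c"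
  shows "hessian f x = A"
proof -
  have "GDERIV f u :> A u + b" for u
  proof -
    have "(f has_derivative (\<lambda>h. 1 / 2 * (u \<bullet> A h + h \<bullet> A u) + b \<bullet> h)) (at u)"
      unfolding f by (auto intro!: derivative_eq_intros)
    \<comment> \<open>Symmetry merges the two halves of the product rule, which absorbs the factor
      1/2.\<close>
    moreover have "u \<bullet> A h = h \<bullet> A u" for h
      using assms(1) by (metis symmetric_op_def inner_commute)
    ultimately show ?thesis
      by (simp add: gderiv_def inner_add_right inner_commute)
  qed
  then have "grad f = (\<lambda>u. A u + b)"
    by (intro ext grad_eqI)
  moreover have "((\<lambda>u. A u + b) has_derivative blinfun_apply A) (at x)"
    by (auto intro!: derivative_eq_intros)
  ultimately show ?thesis
    by (metis hessian_def frechet_derivative_at blinfun_apply_inverse)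
qed

text \<open>Expanding the squared norm makes the objective quadratic again; the center
  \<open>z\<close> enters only the linear and constant terms, so it leaves no trace in the
  Hessian.\<close>

lemma hessian_prox_objective:
  assumes "quadratic_function f"
  shows "hessian (prox_objective \<gamma> f z) x = id_blinfun + \<gamma> *\<^sub>R hessian f x"
proof -
  obtain A b c where A: "symmetric_op A"
    and f: "\<And>x. f x = 1 / 2 * (x \<bullet> A x) + b \<bullet> x + c"
    using assms unfolding quadratic_function_def by blast
  have "hessian (prox_objective \<gamma> f z) x = id_blinfun + \<gamma> *\<^sub>R A"
  proof (rule hessian_quadratic)
    show "symmetric_op (id_blinfun + \<gamma> *\<^sub>R A)"
      using A by (simp add: symmetric_op_def blinfun.add_left blinfun.scaleR_left
          inner_add_left inner_add_right)
    show "prox_objective \<gamma> f z u = 1 / 2 * (u \<bullet> (id_blinfun + \<gamma> *\<^sub>R A) u)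
        + (\<gamma> *\<^sub>R b - z) \<bullet> u + (\<gamma> * c + 1 / 2 * (z \<bullet> z))" for u
      by (simp add: prox_objective_def f power2_norm_eq_inner blinfun.add_left blinfun.scaleR_left
          inner_simps inner_commute algebra_simps)
  qed
  then show ?thesis
    using hessian_quadratic[OF A f] by simp
qed

lemma averaged_hessian_const:
  assumes "\<And>x. hessian \<phi> x = G"
  shows "averaged_hessian \<phi> p d = G"
  by (simp add: averaged_hessian_def assms)

(* N is the (possibly infinite) number of accepted updates; m k is the number of updates
   accepted before outer iteration k, so the model used there is B (m k). *)
theorem proposition5p7:
  fixes G :: "'a::euclidean_space \<Rightarrow>\<^sub>L 'a"
    and B E :: "nat \<Rightarrow> ('a \<Rightarrow>\<^sub>L 'a)"
    and s y v :: "nat \<Rightarrow> 'a"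
    and N :: enat
  assumes G_sym: "symmetric_op G"
    and B0_sym: "symmetric_op (B 0)"
    and secant: "\<And>i. enat i < N \<Longrightarrow> y i = G (s i)"
    and v_eq: "\<And>i. enat i < N \<Longrightarrow> v i = y i - B i (s i)"
    and well_defined: "\<And>i. enat i < N \<Longrightarrow> v i \<bullet> s i \<noteq> 0"
    and SR1: "\<And>i. enat i < N \<Longrightarrow> B (Suc i) = B i + outer (v i) (v i) /\<^sub>R (v i \<bullet> s i)"
    and E_eq: "\<And>i. E i = B i - G"
  shows "(\<forall>i. enat i < N \<longrightarrow>
            E (Suc i) = E i - (E i o\<^sub>L outer (s i) (s i) o\<^sub>L E i) /\<^sub>R (s i \<bullet> E i (s i))
            \<and> E (Suc i) (s i) = 0
            \<and> op_ker (E i) \<subseteq> op_ker (E (Suc i)))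
    \<and> (\<forall>I V. finite I \<longrightarrow> (\<forall>i\<in>I. enat i < N) \<longrightarrow> V = span (s ` I) \<longrightarrow>
          (\<forall>j. enat j \<le> N \<longrightarrow> (\<forall>i\<in>I. i < j) \<longrightarrow> (\<forall>w\<in>V. (B j - G) w = 0))
          \<and> (\<forall>f (\<gamma>::real) z p a d (m :: nat \<Rightarrow> nat).
               quadratic_function f \<longrightarrow> \<gamma> > 0 \<longrightarrow>
               (\<forall>x. G = id_blinfun + \<gamma> *\<^sub>R hessian f x) \<longrightarrow>
               (\<forall>k\<ge>1. is_arg_min (prox_objective \<gamma> f (z k)) (\<lambda>_. True) (p k)) \<longrightarrow>
               (\<forall>k\<ge>1. d k = a (k - 1) - p k) \<longrightarrow>
               mono m \<longrightarrow> (\<forall>k. enat (m k) \<le> N) \<longrightarrow>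
               dennis_more_along
                 {k. k \<ge> 1 \<and> (\<forall>i\<in>I. i < m k) \<and> d k \<noteq> 0 \<and> d k \<in> V}
                 (\<lambda>k. B (m k))
                 (\<lambda>k. averaged_hessian (prox_objective \<gamma> f (z k)) (p k) (d k))
                 d))"
proof -
  have B_sym: "symmetric_op (B i)" if "enat i \<le> N" for i
    using that
  proof (induction i)
    case 0
    show ?case by (rule B0_sym)
  next
    case (Suc i)
    then have "enat i < N"
      by (simp add: Suc_ile_eq)
    then show ?case
      by (simp add: SR1 symmetric_op_rank_one_update Suc.IH)
  qed
  have E_Suc: "E (Suc i) = deflate (E i) (s i)" if "enat i < N" for i
    using SR1_error_update[OF symmetric_op_diff[OF B_sym G_sym], of i "v i" "s i"] that
    by (simp add: SR1 secant v_eq E_eq)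
  \<comment> \<open>This number is \<open>- (v i \<bullet> s i)\<close>, so a well-defined update
    means nonzero curvature of the error along \<open>s i\<close>.\<close>
  have curvature: "s i \<bullet> E i (s i) \<noteq> 0" if "enat i < N" for i
    using well_defined[OF that] secant[OF that] v_eq[OF that]
    by (simp add: E_eq blinfun.diff_left inner_diff_left inner_diff_right inner_commute)
  have step: "E (Suc i) = E i - (E i o\<^sub>L outer (s i) (s i) o\<^sub>L E i) /\<^sub>R (s i \<bullet> E i (s i))
      \<and> E (Suc i) (s i) = 0 \<and> op_ker (E i) \<subseteq> op_ker (E (Suc i))" if "enat i < N" for i
    using E_Suc[OF that] deflate_direction[OF curvature[OF that]] op_ker_deflate
    by (simp add: deflate_def)
  \<comment> \<open>The direction \<open>s i\<close> enters the kernel at index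
    \<open>Suc i\<close>, hence the strict \<open>i < j\<close>; \<open>j = N\<close> is the model
    after the last update. Induction on \<open>j\<close> carries it along.\<close>
  have s_ker: "s i \<in> op_ker (E j)" if "i < j" "enat j \<le> N" for i j
    using that
  proof (induction j)
    case (Suc j)
    have j: "enat j < N"
      using Suc.prems by (simp add: Suc_ile_eq)
    show ?case
    proof (cases "i = j")
      case True
      then show ?thesis
        using step[OF j] unfolding op_ker_def by blast
    next
      case False
      then have "s i \<in> op_ker (E j)"
        using Suc j by simp
      then show ?thesis
        using step[OF j] by blast
    qed
  qed simp
  have span_ker: "(B j - G) w = 0"
    if "enat j \<le> N" "\<forall>i\<in>I. i < j" "w \<in> span (s ` I)" for I j w
  proof -
    have "span (s ` I) \<subseteq> op_ker (E j)"
      using that s_ker by (intro span_minimal subspace_op_ker) auto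
    then show ?thesis
      using that by (auto simp: op_ker_def E_eq)
  qed
  have dm: "dennis_more_along
      {k. k \<ge> 1 \<and> (\<forall>i\<in>I. i < m k) \<and> d k \<noteq> 0 \<and> d k \<in> span (s ` I)} (\<lambda>k. B (m k))
      (\<lambda>k. averaged_hessian (prox_objective \<gamma> f (z k)) (p k) (d k)) d"
    if f: "quadratic_function f" and G: "\<And>x. G = id_blinfun + \<gamma> *\<^sub>R hessian f x"
      and m: "\<And>k. enat (m k) \<le> N"
    for I f \<gamma> z p d and m :: "nat \<Rightarrow> nat"
  proof -
    \<comment> \<open>The integrand is the constant \<open>G\<close> for every center, and the
      interval has length one.\<close>
    have avg: "averaged_hessian (prox_objective \<gamma> f (z k)) (p k) (d k) = G" for k
      by (rule averaged_hessian_const) (metis G hessian_prox_objective[OF f])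
    show ?thesis
      unfolding dennis_more_along_def avg
      \<comment> \<open>Under the restricted filter only indices in the given set count, and there
        \<open>span_ker\<close> at index \<open>m k\<close> makes the numerator zero.\<close>
      by (rule tendsto_eventually)
        (auto simp: eventually_inf_principal span_ker[OF m] intro!: always_eventually)
  qed
  show ?thesis
    by ((rule conjI; intro allI impI), erule step, (intro conjI allI impI ballI; hypsubst),
        (rule span_ker; assumption), (rule dm; blast))
qed

end
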